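(* Let $\phi$ be an entire function on $\mathbb{C}$ and let $\mathfrak{g}_\phi$ be the associated complex Lie algebra of differential operators $$\mathfrak{g}_\phi=\operatorname{span}_{\mathbb{C}}\{1,\ \mathcal{D},\ \mathcal{D}^\dagger,\ x,\ x\phi'(x),\ x^2\phi^{(2)}(x),\ x^3\phi^{(3)}(x),\ldots\}.$$ Then $\dim \mathfrak{g}_\phi$ is finite if and only if $\phi$ is a polynomial. In that case, if $\ell$ is the number of non-zero coefficients of $\phi$ and $$k=\begin{cases}\ell+2 & \text{if } \phi(0)=\phi'(0)=0,\\ \ell+1 & \text{if exactly one of } \phi(0),\phi'(0) \text{ is zero},\\ \ell & \text{if } \phi(0)\neq 0 \text{ and } \phi'(0)\neq 0,\end{cases}$$ then $\dim \mathfrak{g}_\phi = k+2$.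
   Context: Fix $N\in\mathbb{N}$, a real number $\nu>0$ and real numbers $a_1,\dots,a_{N-1}$. Let $E_{i,j}$ be the $N\times N$ matrix units and $$J=\sum_{k=1}^N kE_{k,k},\qquad A=\sum_{k=1}^{N-1}a_kE_{k+1,k}.$$ Differential operators $\mathcal{E}=\sum_j \partial_x^jF_j(x)$ with matrix valued coefficients act from the right on $N\times N$ matrix valued functions by $P\cdot\mathcal{E}=\sum_j P^{(j)}(x)F_j(x)$; products are defined by $P\cdot(\mathcal{E}_1\mathcal{E}_2)=(P\cdot\mathcal{E}_1)\cdot\mathcal{E}_2$ and $[\mathcal{E}_1,\mathcal{E}_2]=\mathcal{E}_1\mathcal{E}_2-\mathcal{E}_2\mathcal{E}_1$. Scalars denote multiples of the identity matrix, and scalar functions of $x$ act by multiplication. Put $$\mathcal{D}=\partial_x x+x(A-1),\qquad \mathcal{D}^\dagger=-\partial_x x-(1+\nu+J)+x\phi'(x)-x.$$ The space $\mathfrak{g}_\phi$ is closed under the commutator bracket.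
   Formalization: The formula dim g_φ = k+2 is stated only for N ≥ 2, since for N = 1 one has D + D† = xφ'(x) − 2x − (2+ν), so D† is redundant and the dimension is k+1 (e.g. φ = 0 gives 3, not 4); the equivalence of finite dimension with φ being a polynomial is stated for all N ≥ 1. *)

theory Defs
  imports
    "HOL-Complex_Analysis.Cauchy_Integral_Formula"
    "HOL-Computational_Algebra.Polynomial"
    "HOL-Library.Function_Algebras"
begin


text \<open>
  An $N \times N$ matrix is a value of type \<open>complex^'n^'n\<close> with \<open>CARD('n) = N\<close>. The
  matrices $J$ and $A$ depend on the numbering of rows and columns, so \<open>'n\<close> is also linearly
  ordered; \<open>pos\<close> is the order isomorphism from \<open>'n\<close> onto $\{1, \dots, N\}$.
\<close>

type_synonym 'n cmat = "((complex, 'n) vec, 'n) vec"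

definition pos :: "'n::{finite,linorder} \<Rightarrow> nat" where
  "pos i = card {..i}"

definition matrix_unit :: "nat \<Rightarrow> nat \<Rightarrow> 'n::{finite,linorder} cmat" where
  "matrix_unit k l = (\<chi> i j. if pos i = k \<and> pos j = l then 1 else 0)"

text \<open>Scalars are written as \<open>mat c\<close>, the multiple \<open>c\<close> of the identity matrix.\<close>

definition J_mat :: "'n::{finite,linorder} cmat" where
  "J_mat = (\<Sum>k = 1..CARD('n). mat (of_nat k) ** matrix_unit k k)"

definition A_mat :: "(nat \<Rightarrow> real) \<Rightarrow> 'n::{finite,linorder} cmat" where
  "A_mat a = (\<Sum>k = 1..<CARD('n). mat (of_real (a k)) ** matrix_unit (k + 1) k)"

text \<open>
  The operator $\sum_j \partial_x^j F_j(x)$ is represented by its coefficient family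
  \<open>\<lambda>j x. F\<^sub>j x\<close>. Operators in the ordinary sense have only finitely many nonzero coefficients;
  this holds for every element of the spans formed below. Lemma \<open>act_inject\<close> shows that such an
  operator is determined by its action on entire functions.
\<close>

type_synonym 'n diffop = "nat \<Rightarrow> complex \<Rightarrow> 'n cmat"

definition dterm :: "nat \<Rightarrow> (complex \<Rightarrow> 'n cmat) \<Rightarrow> 'n::finite diffop" where
  "dterm j F = (\<lambda>i. if i = j then F else 0)"

definition fun_op :: "(complex \<Rightarrow> complex) \<Rightarrow> 'n::finite diffop" where
  "fun_op f = dterm 0 (\<lambda>x. mat (f x))"

definition op_scale :: "complex \<Rightarrow> 'n::finite diffop \<Rightarrow> 'n diffop" where
  "op_scale c E = (\<lambda>j x. mat c ** E j x)"

definition mderiv :: "nat \<Rightarrow> (complex \<Rightarrow> 'n cmat) \<Rightarrow> complex \<Rightarrow> 'n::finite cmat" where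
  "mderiv j P x = (\<chi> r s. (deriv ^^ j) (\<lambda>z. P z $ r $ s) x)"

definition entire_mat :: "(complex \<Rightarrow> 'n::finite cmat) \<Rightarrow> bool" where
  "entire_mat P \<longleftrightarrow> (\<forall>r s. (\<lambda>z. P z $ r $ s) holomorphic_on UNIV)"

definition act :: "(complex \<Rightarrow> 'n cmat) \<Rightarrow> 'n::finite diffop \<Rightarrow> complex \<Rightarrow> 'n cmat" where
  "act P E x = (\<Sum>j | E j \<noteq> 0. mderiv j P x ** E j x)"

text \<open>The right action makes the product $\mathcal{E}_1\mathcal{E}_2$ act by $\mathcal{E}_1$ first.\<close>

definition is_bracket :: "'n::finite diffop \<Rightarrow> 'n diffop \<Rightarrow> 'n diffop \<Rightarrow> bool" where
  "is_bracket E1 E2 E \<longleftrightarrow>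
     (\<forall>P. entire_mat P \<longrightarrow> act P E = act (act P E1) E2 - act (act P E2) E1)"

lemma mat_mult_component: "(mat c ** (M :: 'n::finite cmat)) $ r $ s = c * M $ r $ s"
  by (simp add: matrix_matrix_mult_def mat_def if_distrib[of "\<lambda>u. u * _"] cong: if_cong)

interpretation diffop: vector_space op_scale
  by unfold_locales
    (auto simp: op_scale_def fun_eq_iff vec_eq_iff mat_mult_component algebra_simps)

text \<open>
  Complex dimension is \<open>diffop.dim\<close>. It is \<open>0\<close> on spaces without a finite basis, so
  finiteness of the dimension is stated separately.
\<close>

definition op_finite_dim :: "'n::finite diffop set \<Rightarrow> bool" where
  "op_finite_dim V \<longleftrightarrow> (\<exists>B. finite B \<and> diffop.span B = V)"

definition D_op :: "(nat \<Rightarrow> real) \<Rightarrow> 'n::{finite,linorder} diffop" where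
  "D_op a = dterm 1 (\<lambda>x. mat x) + dterm 0 (\<lambda>x. mat x ** (A_mat a - mat 1))"

definition D_dagger ::
  "real \<Rightarrow> (complex \<Rightarrow> complex) \<Rightarrow> 'n::{finite,linorder} diffop" where
  "D_dagger \<nu> \<phi> = - dterm 1 (\<lambda>x. mat x)
     + dterm 0 (\<lambda>x. - (mat (1 + of_real \<nu>) + J_mat) + mat (x * deriv \<phi> x) - mat x)"

definition g_phi ::
  "real \<Rightarrow> (nat \<Rightarrow> real) \<Rightarrow> (complex \<Rightarrow> complex) \<Rightarrow> 'n::{finite,linorder} diffop set" where
  "g_phi \<nu> a \<phi> = diffop.span
     ({fun_op (\<lambda>x. 1), D_op a, D_dagger \<nu> \<phi>, fun_op (\<lambda>x. x)}
      \<union> {fun_op (\<lambda>x. x ^ j * (deriv ^^ j) \<phi> x) | j. j \<ge> 1})"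

text \<open>
  Sanity checks: \<open>pos\<close> is the numbering $1, \dots, N$; a finite-order operator is determined by
  its action (\<open>act_inject\<close>); and \<open>g_phi\<close> is a Lie algebra under the commutator defined through
  the action (\<open>g_phi_closed_bracket\<close>).
\<close>

lemma bij_betw_pos: "bij_betw (pos :: 'n::{finite,linorder} \<Rightarrow> nat) UNIV {1..CARD('n)}"
proof -
  have lt: "pos i < pos j" if "i < j" for i j :: 'n
    unfolding pos_def using that by (intro psubset_card_mono) auto
  have inj: "inj (pos :: 'n \<Rightarrow> nat)"
    by (rule linorder_injI) (use lt in force)
  have "range (pos :: 'n \<Rightarrow> nat) \<subseteq> {1..CARD('n)}"
    unfolding pos_def by (auto simp: card_mono card_gt_0_iff Suc_le_eq)
  moreover have "card (range (pos :: 'n \<Rightarrow> nat)) = card {1..CARD('n)}"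
    using inj by (simp add: card_image)
  ultimately have "range (pos :: 'n \<Rightarrow> nat) = {1..CARD('n)}"
    by (intro card_subset_eq) auto
  with inj show ?thesis by (simp add: bij_betw_def)
qed

lemma pos_range: "1 \<le> pos (i :: 'n::{finite,linorder})" "pos i \<le> CARD('n)"
  using bij_betw_pos[where 'n = 'n] by (auto simp: bij_betw_def)

lemma pos_eq_iff [simp]: "pos i = pos j \<longleftrightarrow> i = j"
  using bij_betw_pos[where 'n = 'a] by (auto simp: bij_betw_def inj_on_def)

lemma J_mat_component:
  "(J_mat :: 'n::{finite,linorder} cmat) $ r $ s = (if r = s then of_nat (pos r) else 0)"
proof -
  have "(J_mat :: 'n cmat) $ r $ s
      = (\<Sum>k = 1..CARD('n). if k = pos r then (if r = s then of_nat k else 0) else 0)"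
    unfolding J_mat_def sum_component
    by (intro sum.cong) (auto simp: mat_mult_component matrix_unit_def)
  also have "\<dots> = (if r = s then of_nat (pos r) else 0)"
    using pos_range[of r] by (simp add: sum.delta)
  finally show ?thesis .
qed

lemma A_mat_component:
  "(A_mat a :: 'n::{finite,linorder} cmat) $ r $ s
     = (if pos r = pos s + 1 then of_real (a (pos s)) else 0)"
proof -
  have "(A_mat a :: 'n cmat) $ r $ s
      = (\<Sum>k = 1..<CARD('n). if k = pos s then (if pos r = pos s + 1 then of_real (a k) else 0) else 0)"
    unfolding A_mat_def sum_component
    by (intro sum.cong) (auto simp: mat_mult_component matrix_unit_def)
  also have "\<dots> = (if pos r = pos s + 1 then of_real (a (pos s)) else 0)"
    using pos_range[of s] pos_range(2)[of r] by (auto simp: sum.delta)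
  finally show ?thesis .
qed

lemma act_bounded:
  assumes "\<And>j. j > n \<Longrightarrow> E j = 0"
  shows "act P E x = (\<Sum>j\<le>n. mderiv j P x ** E j x)"
  unfolding act_def
  by (rule sum.mono_neutral_left) (use assms not_le in \<open>auto simp: not_le\<close>)

lemma act_inject:
  fixes E F :: "'n::finite diffop"
  assumes "finite {j. E j \<noteq> 0}" "finite {j. F j \<noteq> 0}"
    and eq: "\<And>P. entire_mat P \<Longrightarrow> act P E = act P F"
  shows "E = F"
proof (intro ext)
  fix k x0
  have deriv_pow: "(deriv ^^ i) (\<lambda>z. c * (z - x0) ^ k) x0 = (if i = k then c * fact k else 0)"
    for i and c :: complex
  proof -
    have "(deriv ^^ i) (\<lambda>z. c * (z - x0) ^ k) x0 = c * (deriv ^^ i) (\<lambda>z. (z - x0) ^ k) x0"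
      using higher_deriv_mult[of "\<lambda>_. c" UNIV "\<lambda>z. (z - x0) ^ k" x0 i]
      by (simp add: holomorphic_intros higher_deriv_const if_distrib[of "\<lambda>u. _ * u"]
            if_distrib[of "\<lambda>u. u * _"] cong: if_cong)
    also have "(deriv ^^ i) (\<lambda>z. (z - x0) ^ k)
        = (\<lambda>z. of_nat (\<Prod>m<i. k - m) * (z - x0) ^ (k - i))"
    proof (induction i)
      case (Suc i)
      have "deriv (\<lambda>z. of_nat (\<Prod>m<i. k - m) * (z - x0) ^ (k - i)) z
          = of_nat (\<Prod>m<Suc i. k - m) * (z - x0) ^ (k - Suc i)" for z
        by (intro DERIV_imp_deriv) (auto intro!: derivative_eq_intros)
      with Suc show ?case by simp
    qed simp
    also have "of_nat (\<Prod>m<i. k - m) * (x0 - x0) ^ (k - i) = (if i = k then fact k else 0 :: complex)"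
      by (cases i k rule: linorder_cases)
        (auto simp: fact_prod_rev lessThan_atLeast0 simp flip: of_nat_prod)
    finally show ?thesis by simp
  qed
  define P :: "complex \<Rightarrow> 'n cmat" where "P = (\<lambda>z. mat ((z - x0) ^ k))"
  have P: "entire_mat P"
    unfolding entire_mat_def
  proof (intro allI)
    fix r s :: 'n
    show "(\<lambda>z. P z $ r $ s) holomorphic_on UNIV"
      by (cases "r = s") (auto simp: P_def mat_def intro!: holomorphic_intros)
  qed
  have md: "mderiv i P x0 = (if i = k then mat (fact k) else 0)" for i
  proof (rule vec_eq_iff[THEN iffD2, rule_format], rule vec_eq_iff[THEN iffD2, rule_format])
    fix r s
    have "(\<lambda>z. P z $ r $ s) = (\<lambda>z. (if r = s then 1 else 0) * (z - x0) ^ k)"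
      by (auto simp: P_def mat_def)
    then show "mderiv i P x0 $ r $ s = (if i = k then mat (fact k) else 0 :: 'n cmat) $ r $ s"
      by (simp add: mderiv_def deriv_pow mat_def)
  qed
  have act: "act P H x0 = mat (fact k) ** H k x0" if "finite {j. H j \<noteq> 0}" for H :: "'n diffop"
  proof -
    have "act P H x0 = (\<Sum>j | H j \<noteq> 0. if j = k then mat (fact k) ** H k x0 else 0)"
      unfolding act_def by (intro sum.cong) (auto simp: md)
    also have "\<dots> = mat (fact k) ** H k x0"
      using that by (auto simp: sum.delta)
    finally show ?thesis .
  qed
  have "mat (fact k) ** E k x0 = mat (fact k) ** F k x0"
    using eq[OF P] act assms(1,2) by metis
  then show "E k x0 = F k x0"
    by (simp add: vec_eq_iff mat_mult_component)
qed

text \<open>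
  \<open>normal_op \<nu> a \<phi> c d f\<close> is $c\mathcal{D} + d\mathcal{D}^\dagger + f(x)$ with its coefficients
  collected, see \<open>normal_op_combination\<close>.
\<close>

definition G_fun :: "real \<Rightarrow> (nat \<Rightarrow> real) \<Rightarrow> (complex \<Rightarrow> complex) \<Rightarrow> complex \<Rightarrow> complex
    \<Rightarrow> (complex \<Rightarrow> complex) \<Rightarrow> complex \<Rightarrow> 'n::{finite,linorder} cmat" where
  "G_fun \<nu> a \<phi> c d f x = (\<chi> r s. c * x * A_mat a $ r $ s + (if r = s then
     - c * x + d * (- (1 + of_real \<nu>) - of_nat (pos r) + x * deriv \<phi> x - x) + f x else 0))"

definition normal_op :: "real \<Rightarrow> (nat \<Rightarrow> real) \<Rightarrow> (complex \<Rightarrow> complex) \<Rightarrow> complex \<Rightarrow> complex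
    \<Rightarrow> (complex \<Rightarrow> complex) \<Rightarrow> 'n::{finite,linorder} diffop" where
  "normal_op \<nu> a \<phi> c d f
     = dterm 1 (\<lambda>x. mat ((c - d) * x)) + dterm 0 (G_fun \<nu> a \<phi> c d f)"

lemma fun_op_eq_normal_op: "fun_op f = normal_op \<nu> a \<phi> 0 0 f"
  by (auto simp: fun_op_def normal_op_def dterm_def G_fun_def fun_eq_iff vec_eq_iff mat_def)

lemma normal_op_combination:
  "normal_op \<nu> a \<phi> c d f = op_scale c (D_op a) + op_scale d (D_dagger \<nu> \<phi>) + fun_op f"
  by (auto simp: fun_op_def normal_op_def dterm_def G_fun_def fun_eq_iff vec_eq_iff
        op_scale_def D_op_def D_dagger_def mat_mult_component J_mat_component)
    (auto simp: mat_def algebra_simps)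

definition scalar_part where
  "scalar_part g f \<longleftrightarrow> f holomorphic_on UNIV \<and> fun_op f \<in> g \<and> fun_op (\<lambda>x. x * deriv f x) \<in> g"

lemma act_normal_op:
  "act P (normal_op \<nu> a \<phi> c d f) x = (\<chi> r s. (c - d) * x * deriv (\<lambda>z. P z $ r $ s) x
     + (\<Sum>t\<in>UNIV. P x $ r $ t * G_fun \<nu> a \<phi> c d f x $ t $ s))"
  by (subst act_bounded[where n = 1])
    (auto simp: normal_op_def dterm_def mderiv_def matrix_matrix_mult_def mat_def vec_eq_iff
      if_distrib[of "\<lambda>u. _ * u"] mult_ac cong: if_cong)

lemma scalar_part_combine:
  assumes "scalar_part (g_phi \<nu> a \<phi> :: 'n::{finite,linorder} diffop set) f"
    and "scalar_part (g_phi \<nu> a \<phi> :: 'n diffop set) h"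
  shows "scalar_part (g_phi \<nu> a \<phi> :: 'n diffop set) (\<lambda>x. k * f x + h x)"
proof -
  have hol: "f holomorphic_on UNIV" "h holomorphic_on UNIV"
    using assms by (auto simp: scalar_part_def)
  then have "(f has_field_derivative deriv f x) (at x)" "(h has_field_derivative deriv h x) (at x)"
    for x by (auto intro!: holomorphic_derivI)
  then have d: "deriv (\<lambda>x. k * f x + h x) x = k * deriv f x + deriv h x" for x
    by (intro DERIV_imp_deriv DERIV_add DERIV_cmult)
  have lin: "fun_op (\<lambda>x. k * u x + v x) = op_scale k (fun_op u :: 'n diffop) + fun_op v" for u v
    by (auto simp: fun_op_def dterm_def fun_eq_iff vec_eq_iff op_scale_def mat_mult_component)
      (auto simp: mat_def)
  have e: "(\<lambda>x. x * deriv (\<lambda>x. k * f x + h x) x)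
      = (\<lambda>x. k * (x * deriv f x) + x * deriv h x)"
    by (simp only: d) (simp add: algebra_simps)
  show ?thesis
    using assms hol unfolding scalar_part_def e lin g_phi_def
    by (auto intro!: diffop.span_add diffop.span_scale holomorphic_intros)
qed

lemma normal_op_linear:
  "normal_op \<nu> a \<phi> (k * c + c') (k * d + d') (\<lambda>x. k * f x + f' x)
     = op_scale k (normal_op \<nu> a \<phi> c d f) + normal_op \<nu> a \<phi> c' d' f'"
  by (auto simp: normal_op_def dterm_def G_fun_def fun_eq_iff vec_eq_iff op_scale_def
        mat_mult_component algebra_simps) (auto simp: mat_def algebra_simps)

lemma g_phi_normal:
  assumes \<phi>: "\<phi> holomorphic_on UNIV"
    and E: "E \<in> (g_phi \<nu> a \<phi> :: 'n::{finite,linorder} diffop set)"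
  shows "\<exists>c d f. scalar_part (g_phi \<nu> a \<phi> :: 'n diffop set) f \<and> E = normal_op \<nu> a \<phi> c d f"
proof -
  let ?g = "g_phi \<nu> a \<phi> :: 'n diffop set"
  have base: "fun_op (\<lambda>x. 1) \<in> ?g" "fun_op (\<lambda>x. x) \<in> ?g"
    "\<And>j. j \<ge> 1 \<Longrightarrow> fun_op (\<lambda>x. x ^ j * (deriv ^^ j) \<phi> x) \<in> ?g"
    unfolding g_phi_def by (blast intro: diffop.span_base)+
  have "fun_op (\<lambda>x. 0) = op_scale 0 (fun_op (\<lambda>x. 1) :: 'n diffop)"
    by (auto simp: fun_op_def dterm_def fun_eq_iff op_scale_def)
  then have zero: "fun_op (\<lambda>x. 0) \<in> ?g"
    using diffop.span_scale[OF base(1)[unfolded g_phi_def], of 0] unfolding g_phi_def by simp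
  have s0: "scalar_part ?g (\<lambda>x. 0)" and s1: "scalar_part ?g (\<lambda>x. 1)"
    and sx: "scalar_part ?g (\<lambda>x. x)"
    using base(1,2) zero by (auto simp: scalar_part_def intro!: holomorphic_intros)
  have sj: "scalar_part ?g (\<lambda>x. x ^ j * (deriv ^^ j) \<phi> x)" if "j \<ge> 1" for j
  proof -
    have "((deriv ^^ j) \<phi> has_field_derivative (deriv ^^ Suc j) \<phi> x) (at x)" for x
      using has_field_derivative_higher_deriv[OF \<phi>, of x j] by simp
    then have "deriv (\<lambda>x. x ^ j * (deriv ^^ j) \<phi> x) x
        = of_nat j * x ^ (j - 1) * (deriv ^^ j) \<phi> x + x ^ j * (deriv ^^ Suc j) \<phi> x" for x
      by (intro DERIV_imp_deriv) (auto intro!: derivative_eq_intros)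
    moreover have "x * (of_nat j * x ^ (j - 1) * y) = of_nat j * (x ^ j * y)" for x y :: complex
      using that by (cases j) auto
    ultimately have e: "(\<lambda>x. x * deriv (\<lambda>x. x ^ j * (deriv ^^ j) \<phi> x) x)
        = (\<lambda>x. of_nat j * (x ^ j * (deriv ^^ j) \<phi> x) + x ^ Suc j * (deriv ^^ Suc j) \<phi> x)"
      by (simp only: distrib_left power_Suc mult.assoc)
    have "fun_op (\<lambda>x. of_nat j * (x ^ j * (deriv ^^ j) \<phi> x) + x ^ Suc j * (deriv ^^ Suc j) \<phi> x)
        = op_scale (of_nat j) (fun_op (\<lambda>x. x ^ j * (deriv ^^ j) \<phi> x) :: 'n diffop)
          + fun_op (\<lambda>x. x ^ Suc j * (deriv ^^ Suc j) \<phi> x)"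
      by (auto simp: fun_op_def dterm_def fun_eq_iff vec_eq_iff op_scale_def mat_mult_component)
        (auto simp: mat_def)
    then have "fun_op (\<lambda>x. x * deriv (\<lambda>x. x ^ j * (deriv ^^ j) \<phi> x) x) \<in> ?g"
      unfolding e using base(3)[OF that] base(3)[of "Suc j"]
      by (auto simp: g_phi_def intro!: diffop.span_add diffop.span_scale)
    then show ?thesis
      using base(3)[OF that] \<phi> by (auto simp: scalar_part_def intro!: holomorphic_intros)
  qed
  from E[unfolded g_phi_def] show ?thesis
  proof (induction rule: diffop.span_induct_alt)
    case base
    have "0 = (normal_op \<nu> a \<phi> 0 0 (\<lambda>x. 0) :: 'n diffop)"
      by (auto simp: normal_op_def dterm_def G_fun_def fun_eq_iff vec_eq_iff)
    then show ?case using s0 by blast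
  next
    case (step k E F)
    from step(2) obtain c' d' f' where F:
      "scalar_part ?g f'" "F = normal_op \<nu> a \<phi> c' d' f'" by blast
    have "D_op a = (normal_op \<nu> a \<phi> 1 0 (\<lambda>x. 0) :: 'n diffop)"
      "D_dagger \<nu> \<phi> = (normal_op \<nu> a \<phi> 0 1 (\<lambda>x. 0) :: 'n diffop)"
      by (simp_all add: normal_op_combination)
        (auto simp: fun_op_def dterm_def fun_eq_iff)
    moreover have "\<exists>c d f'. scalar_part ?g f' \<and> fun_op f = normal_op \<nu> a \<phi> c d f'"
      if "scalar_part ?g f" for f
      using that fun_op_eq_normal_op by blast
    ultimately have "\<exists>c d f. scalar_part ?g f \<and> E = normal_op \<nu> a \<phi> c d f"
      using step(1) s0 s1 sx sj by (elim UnE insertE CollectE exE conjE emptyE) blast+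
    then obtain c d f where E: "scalar_part ?g f" "E = normal_op \<nu> a \<phi> c d f" by blast
    show ?case
      unfolding E(2) F(2) normal_op_linear[symmetric]
      using scalar_part_combine[OF E(1) F(1), of k] by blast
  qed
qed

lemma g_phi_closed_bracket:
  fixes E1 E2 :: "'n::{finite,linorder} diffop"
  assumes \<phi>: "\<phi> holomorphic_on UNIV" and E: "E1 \<in> g_phi \<nu> a \<phi>" "E2 \<in> g_phi \<nu> a \<phi>"
  shows "\<exists>E \<in> g_phi \<nu> a \<phi>. is_bracket E1 E2 E"
proof -
  let ?g = "g_phi \<nu> a \<phi> :: 'n diffop set"
  obtain c1 d1 f1 where 1: "scalar_part ?g f1" "E1 = normal_op \<nu> a \<phi> c1 d1 f1"
    using g_phi_normal[OF \<phi> E(1)] by blast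
  obtain c2 d2 f2 where 2: "scalar_part ?g f2" "E2 = normal_op \<nu> a \<phi> c2 d2 f2"
    using g_phi_normal[OF \<phi> E(2)] by blast
  define w where "w = c1 * d2 - d1 * c2"
  define h where "h = (\<lambda>x. w * (2 * x - x * deriv \<phi> x - x ^ 2 * deriv (deriv \<phi>) x)
    + (c2 - d2) * (x * deriv f1 x) - (c1 - d1) * (x * deriv f2 x))"
  have base: "fun_op (\<lambda>x. x) \<in> ?g"
    "\<And>j. j \<ge> 1 \<Longrightarrow> fun_op (\<lambda>x. x ^ j * (deriv ^^ j) \<phi> x) \<in> ?g"
    unfolding g_phi_def by (blast intro: diffop.span_base)+
  from base(2)[of 1] base(2)[of 2]
  have base': "fun_op (\<lambda>x. x * deriv \<phi> x) \<in> ?g" "fun_op (\<lambda>x. x ^ 2 * deriv (deriv \<phi>) x) \<in> ?g"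
    by (simp_all add: numeral_2_eq_2)
  have "fun_op h = op_scale (2 * w) (fun_op (\<lambda>x. x) :: 'n diffop)
      + op_scale (- w) (fun_op (\<lambda>x. x * deriv \<phi> x))
      + op_scale (- w) (fun_op (\<lambda>x. x ^ 2 * deriv (deriv \<phi>) x))
      + op_scale (c2 - d2) (fun_op (\<lambda>x. x * deriv f1 x))
      + op_scale (d1 - c1) (fun_op (\<lambda>x. x * deriv f2 x))"
    by (auto simp: fun_op_def dterm_def fun_eq_iff vec_eq_iff op_scale_def mat_mult_component h_def)
      (auto simp: mat_def algebra_simps)
  also have "\<dots> \<in> ?g"
    using base(1) base' 1(1) 2(1) unfolding scalar_part_def g_phi_def
    by (intro diffop.span_add diffop.span_scale) auto
  finally have h: "fun_op h \<in> ?g" .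
  have "is_bracket E1 E2 (fun_op h)"
    unfolding is_bracket_def
  proof (intro allI impI ext)
    fix P :: "complex \<Rightarrow> 'n cmat" and x
    assume P: "entire_mat P"
    define p where "p r s = deriv (\<lambda>z. P z $ r $ s)" for r s
    have dP: "((\<lambda>z. P z $ r $ s) has_field_derivative p r s x) (at x)" for r s x
      using P unfolding entire_mat_def p_def by (auto intro!: holomorphic_derivI)
    have "p r s holomorphic_on UNIV" for r s
      using P unfolding entire_mat_def p_def by (auto intro!: holomorphic_deriv)
    then have dp: "(p r s has_field_derivative deriv (p r s) x) (at x)" for r s x
      by (auto intro!: holomorphic_derivI)
    have dphi: "(deriv \<phi> has_field_derivative deriv (deriv \<phi>) x) (at x)" for x
      by (rule holomorphic_derivI[OF holomorphic_deriv[OF \<phi>]]) auto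
    define G' where "G' c d f x t s = c * A_mat a $ t $ s + (if t = s then
       - c + d * (deriv \<phi> x + x * deriv (deriv \<phi>) x - 1) + deriv f x else 0)"
      for c d f x and t s :: 'n
    have dG: "((\<lambda>x. G_fun \<nu> a \<phi> c d f x $ t $ s) has_field_derivative G' c d f x t s) (at x)"
      if "scalar_part ?g f" for c d f x and t s :: 'n
    proof -
      have "(f has_field_derivative deriv f x) (at x)"
        using that unfolding scalar_part_def by (auto intro!: holomorphic_derivI)
      then show ?thesis
        unfolding G_fun_def G'_def using dphi[of x]
        by (cases "t = s") (auto intro!: derivative_eq_intros simp: algebra_simps)
    qed
    have two: "act (act P (normal_op \<nu> a \<phi> c d f)) (normal_op \<nu> a \<phi> c' d' f') x $ r $ s
      = (c' - d') * x * ((c - d) * (p r s x + x * deriv (p r s) x)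
          + (\<Sum>t\<in>UNIV. p r t x * G_fun \<nu> a \<phi> c d f x $ t $ s + P x $ r $ t * G' c d f x t s))
        + (\<Sum>t\<in>UNIV. ((c - d) * x * p r t x
          + (\<Sum>u\<in>UNIV. P x $ r $ u * G_fun \<nu> a \<phi> c d f x $ u $ t))
             * G_fun \<nu> a \<phi> c' d' f' x $ t $ s)"
      if f: "scalar_part ?g f" for c d f c' d' f' r s
    proof -
      have "((\<lambda>z. act P (normal_op \<nu> a \<phi> c d f) z $ r $ s) has_field_derivative
          ((c - d) * (p r s x + x * deriv (p r s) x)
          + (\<Sum>t\<in>UNIV. p r t x * G_fun \<nu> a \<phi> c d f x $ t $ s + P x $ r $ t * G' c d f x t s))) (at x)"
        unfolding act_normal_op
        by (auto intro!: derivative_eq_intros dP dp dG[OF f] simp flip: p_def)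
          (auto simp: algebra_simps)
      from DERIV_imp_deriv[OF this] show ?thesis
        by (subst act_normal_op) (simp add: act_normal_op p_def)
    qed
    define C where "C t s = x * ((c2 - d2) * G' c1 d1 f1 x t s - (c1 - d1) * G' c2 d2 f2 x t s)
      + ((\<Sum>u\<in>UNIV. G_fun \<nu> a \<phi> c1 d1 f1 x $ t $ u * G_fun \<nu> a \<phi> c2 d2 f2 x $ u $ s)
        - (\<Sum>u\<in>UNIV. G_fun \<nu> a \<phi> c2 d2 f2 x $ t $ u * G_fun \<nu> a \<phi> c1 d1 f1 x $ u $ s))"
      for t s :: 'n
    have C: "C t s = (if t = s then h x else 0)" for t s
    proof -
      define b1 where "b1 t = - c1 * x
        + d1 * (- (1 + of_real \<nu>) - of_nat (pos t) + x * deriv \<phi> x - x) + f1 x" for t :: 'n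
      define b2 where "b2 t = - c2 * x
        + d2 * (- (1 + of_real \<nu>) - of_nat (pos t) + x * deriv \<phi> x - x) + f2 x" for t :: 'n
      let ?A = "A_mat a :: 'n cmat"
      have G1: "G_fun \<nu> a \<phi> c1 d1 f1 x $ t $ s
          = c1 * x * ?A $ t $ s + (if t = s then b1 t else 0)" for t s
        by (simp add: G_fun_def b1_def)
      have G2: "G_fun \<nu> a \<phi> c2 d2 f2 x $ t $ s
          = c2 * x * ?A $ t $ s + (if t = s then b2 t else 0)" for t s
        by (simp add: G_fun_def b2_def)
      have S1: "(\<Sum>u\<in>UNIV. G_fun \<nu> a \<phi> c1 d1 f1 x $ t $ u * G_fun \<nu> a \<phi> c2 d2 f2 x $ u $ s)
          = c1 * c2 * x ^ 2 * (\<Sum>u\<in>UNIV. ?A $ t $ u * ?A $ u $ s)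
            + c1 * x * ?A $ t $ s * b2 s + b1 t * c2 * x * ?A $ t $ s
            + (if t = s then b1 t * b2 t else 0)"
        unfolding G1 G2
        by (simp add: algebra_simps sum.distrib sum_distrib_left power2_eq_square
            if_distrib[of "\<lambda>u. _ * u"] if_distrib[of "\<lambda>u. u * _"] sum.delta cong: if_cong)
      have S2: "(\<Sum>u\<in>UNIV. G_fun \<nu> a \<phi> c2 d2 f2 x $ t $ u * G_fun \<nu> a \<phi> c1 d1 f1 x $ u $ s)
          = c1 * c2 * x ^ 2 * (\<Sum>u\<in>UNIV. ?A $ t $ u * ?A $ u $ s)
            + c2 * x * ?A $ t $ s * b1 s + b2 t * c1 * x * ?A $ t $ s
            + (if t = s then b1 t * b2 t else 0)"
        unfolding G1 G2
        by (simp add: algebra_simps sum.distrib sum_distrib_left power2_eq_square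
            if_distrib[of "\<lambda>u. _ * u"] if_distrib[of "\<lambda>u. u * _"] sum.delta cong: if_cong)
      have "?A $ t $ s * of_nat (pos t) = ?A $ t $ s * (of_nat (pos s) + 1)"
        by (simp add: A_mat_component)
      then have A: "?A $ t $ s * of_nat (pos t) - ?A $ t $ s * of_nat (pos s) = ?A $ t $ s"
        by (simp add: algebra_simps)
      have D: "c1 * x * ?A $ t $ s * b2 s + b1 t * c2 * x * ?A $ t $ s
          - (c2 * x * ?A $ t $ s * b1 s + b2 t * c1 * x * ?A $ t $ s)
          = x * (c1 * d2 - d1 * c2)
            * (?A $ t $ s * of_nat (pos t) - ?A $ t $ s * of_nat (pos s))"
        unfolding b1_def b2_def by (simp add: algebra_simps)
      have "C t s = x * ((c2 - d2) * G' c1 d1 f1 x t s - (c1 - d1) * G' c2 d2 f2 x t s)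
          + x * (c1 * d2 - d1 * c2) * ?A $ t $ s"
        unfolding C_def S1 S2 D[unfolded A, symmetric] by simp
      then show ?thesis
        by (cases "t = s") (simp_all add: G'_def h_def w_def algebra_simps power2_eq_square)
    qed
    show "act P (fun_op h) x = (act (act P E1) E2 - act (act P E2) E1) x"
    proof (rule vec_eq_iff[THEN iffD2, rule_format], rule vec_eq_iff[THEN iffD2, rule_format])
      fix r s
      have swap: "(\<Sum>t\<in>UNIV. (\<Sum>u\<in>UNIV. P x $ r $ u * U u t) * V t)
          = (\<Sum>t\<in>UNIV. P x $ r $ t * (\<Sum>u\<in>UNIV. U t u * V u))" for U :: "'n \<Rightarrow> 'n \<Rightarrow> complex" and V
        by (simp add: sum_distrib_left sum_distrib_right mult.assoc) (rule sum.swap)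
      have "(act (act P E1) E2 - act (act P E2) E1) x $ r $ s = (\<Sum>t\<in>UNIV. P x $ r $ t * C t s)"
      proof -
        define I where "I G H = (\<Sum>t\<in>UNIV. P x $ r $ t * (\<Sum>u\<in>UNIV. G t u * H u))"
          for G :: "'n \<Rightarrow> 'n \<Rightarrow> complex" and H
        define S where "S v w = (\<Sum>t\<in>UNIV. v t * w t)" for v w :: "'n \<Rightarrow> complex"
        have e1: "(\<Sum>t\<in>UNIV. (k * p r t x + (\<Sum>u\<in>UNIV. P x $ r $ u * U u t)) * V t)
            = k * S (\<lambda>t. p r t x) V + I U V" for k U V
          unfolding I_def S_def swap[symmetric]
          by (simp add: distrib_right sum.distrib sum_distrib_left mult.assoc)
        have e2: "(\<Sum>t\<in>UNIV. p r t x * V t + P x $ r $ t * W t)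
            = S (\<lambda>t. p r t x) V + S (\<lambda>t. P x $ r $ t) W" for V W
          by (simp add: S_def sum.distrib)
        have e3: "(\<Sum>t\<in>UNIV. P x $ r $ t * C t s)
            = x * ((c2 - d2) * S (\<lambda>t. P x $ r $ t) (\<lambda>t. G' c1 d1 f1 x t s)
                 - (c1 - d1) * S (\<lambda>t. P x $ r $ t) (\<lambda>t. G' c2 d2 f2 x t s))
              + (I (\<lambda>t u. G_fun \<nu> a \<phi> c1 d1 f1 x $ t $ u) (\<lambda>u. G_fun \<nu> a \<phi> c2 d2 f2 x $ u $ s)
               - I (\<lambda>t u. G_fun \<nu> a \<phi> c2 d2 f2 x $ t $ u) (\<lambda>u. G_fun \<nu> a \<phi> c1 d1 f1 x $ u $ s))"
        proof -
          let ?S1 = "\<lambda>t. \<Sum>u\<in>UNIV. G_fun \<nu> a \<phi> c1 d1 f1 x $ t $ u * G_fun \<nu> a \<phi> c2 d2 f2 x $ u $ s"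
          let ?S2 = "\<lambda>t. \<Sum>u\<in>UNIV. G_fun \<nu> a \<phi> c2 d2 f2 x $ t $ u * G_fun \<nu> a \<phi> c1 d1 f1 x $ u $ s"
          have "P x $ r $ t * C t s = x * (c2 - d2) * (P x $ r $ t * G' c1 d1 f1 x t s)
              - x * (c1 - d1) * (P x $ r $ t * G' c2 d2 f2 x t s)
              + (P x $ r $ t * ?S1 t - P x $ r $ t * ?S2 t)" for t
            unfolding C_def
            by (simp only: distrib_left right_diff_distrib left_diff_distrib) (simp only: mult_ac)
          then have "(\<Sum>t\<in>UNIV. P x $ r $ t * C t s)
              = x * (c2 - d2) * S (\<lambda>t. P x $ r $ t) (\<lambda>t. G' c1 d1 f1 x t s)
                - x * (c1 - d1) * S (\<lambda>t. P x $ r $ t) (\<lambda>t. G' c2 d2 f2 x t s)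
                + ((\<Sum>t\<in>UNIV. P x $ r $ t * ?S1 t) - (\<Sum>t\<in>UNIV. P x $ r $ t * ?S2 t))"
            unfolding S_def by (simp only: sum.distrib sum_subtractf sum_distrib_left)
          then show ?thesis
            unfolding I_def by (simp only: right_diff_distrib left_diff_distrib mult.assoc)
        qed
        show ?thesis
          unfolding fun_diff_def vector_minus_component 1(2) 2(2) two[OF 1(1)] two[OF 2(1)]
            e1 e2 e3
          by (simp add: algebra_simps)
      qed
      also have "\<dots> = P x $ r $ s * h x"
        by (simp add: C if_distrib[of "\<lambda>u. _ * u"] sum.delta cong: if_cong)
      also have "\<dots> = act P (fun_op h) x $ r $ s"
        by (subst act_bounded[where n = 0])
          (auto simp: fun_op_def dterm_def mderiv_def matrix_matrix_mult_def mat_def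
            if_distrib[of "\<lambda>u. _ * u"] cong: if_cong)
      finally show "act P (fun_op h) x $ r $ s
        = (act (act P E1) E2 - act (act P E2) E1) x $ r $ s" by simp
    qed
  qed
  with h show ?thesis by blast
qed

end

theory Submission
  imports Defs
begin

text \<open>
  Everything rests on how the functions $f_j = x^j\phi^{(j)}(x)$ look in terms of the Taylor
  coefficients $c_n$ of $\phi$: the operator $x^j\partial_x^j$ is diagonal on monomials, so
  $f_j = \sum_n (n)_j c_n x^n$ with the falling factorial
  $(n)_j = n(n-1)\cdots(n-j+1) = j!\binom{n}{j}$ (\<open>euler_power_series\<close>).

  If $\mathfrak{g}_\phi$ is finite dimensional, then some nontrivial combination
  $\sum_j b_jf_j$ vanishes, that is, $q(n)c_n = 0$ for all $n$ where
  $q(n) = \sum_j b_j (n)_j$. The falling factorials are linearly independent polynomials in $n$,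
  so $q$ has only finitely many roots and $c_n = 0$ for all large $n$
  (\<open>polynomial_if_euler_relation\<close>).

  If $\phi$ is a polynomial, the array $(n)_j$ is triangular with diagonal entries
  $j! \neq 0$. Hence the $f_j$ with $j \ge 1$ span exactly the monomials $x^n$ with $n \ge 1$ and
  $c_n \neq 0$ (\<open>taylor_term_in_span\<close>), and together with $1$ and $x$ one gets the $x^n$ with
  $n \in S = \{0, 1\} \cup \{n : c_n \neq 0\}$. The set $S$ has $k$ elements, since $\ell$ counts
  $0$ and $1$ exactly when $\phi(0)$ and $\phi'(0)$ are nonzero. Finally $\mathcal{D}$ and
  $\mathcal{D}^\dagger$ add two dimensions (\<open>independent_g_phi_basis\<close>): cancelling the
  first order terms leaves only multiples of
  $\mathcal{D} + \mathcal{D}^\dagger$, whose value at $x = 0$ is $-(1+\nu+J)$ and is not scalar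
  when $N \ge 2$.
\<close>


section \<open>Linearly independent families\<close>

lemma (in vector_space) independent_family:
  assumes "finite I"
    and rel: "\<And>b. (\<Sum>j\<in>I. scale (b j) (f j)) = 0 \<Longrightarrow> \<forall>j\<in>I. b j = 0"
  shows "inj_on f I" and "independent (f ` I)"
proof -
  show inj: "inj_on f I"
  proof (rule inj_onI, rule ccontr)
    fix i j assume ij: "i \<in> I" "j \<in> I" "f i = f j" "i \<noteq> j"
    \<comment> \<open>A repeated member gives the nontrivial relation $f_i - f_j = 0$.\<close>
    define b where "b m = (if m = i then 1 else 0) - (if m = j then 1 else (0::'a))" for m
    have "scale (b m) (f m) = (if m = i then f i else 0) - (if m = j then f j else 0)" for m
      using ij(4) by (simp add: b_def)
    then have "(\<Sum>m\<in>I. scale (b m) (f m))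
        = (\<Sum>m\<in>I. if m = i then f i else 0) - (\<Sum>m\<in>I. if m = j then f j else 0)"
      by (simp only: sum_subtractf)
    also have "\<dots> = 0"
      using ij(1-3) \<open>finite I\<close> by simp
    finally have "b i = 0"
      by (rule rel[THEN bspec, OF _ ij(1)])
    with ij(4) show False
      by (simp add: b_def)
  qed
  show "independent (f ` I)"
  proof (rule independent_if_scalars_zero)
    show "finite (f ` I)" using \<open>finite I\<close> by simp
  next
    fix u v assume "(\<Sum>v\<in>f ` I. scale (u v) v) = 0" "v \<in> f ` I"
    then show "u v = 0"
      using rel[of "u \<circ> f"] by (auto simp: sum.reindex[OF inj])
  qed
qed

lemma (in vector_space) dependent_sequence:
  fixes f :: "nat \<Rightarrow> 'b"
  assumes "finite B" and "\<And>j. j \<ge> 1 \<Longrightarrow> f j \<in> span B"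
  obtains m b where "(\<Sum>j = 1..m. scale (b j) (f j)) = 0" "\<exists>j\<in>{1..m}. b j \<noteq> 0"
proof -
  let ?I = "{1..card B + 1}"
  have "\<exists>b. (\<Sum>j\<in>?I. scale (b j) (f j)) = 0 \<and> (\<exists>j\<in>?I. b j \<noteq> 0)"
  proof (rule ccontr)
    assume "\<not> ?thesis"
    then have rel: "\<forall>j\<in>?I. b j = 0" if "(\<Sum>j\<in>?I. scale (b j) (f j)) = 0" for b
      using that by blast
    have "inj_on f ?I" "independent (f ` ?I)"
      by (rule independent_family[OF finite_atLeastAtMost rel], assumption)+
    moreover have "f ` ?I \<subseteq> span B"
      using assms(2) by auto
    ultimately show False
      using independent_span_bound[OF \<open>finite B\<close>, of "f ` ?I"] by (simp add: card_image)
  qed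
  with that show ?thesis by blast
qed


section \<open>Taylor coefficients of $x^j\phi^{(j)}$\<close>

abbreviation taylor_coeff :: "(complex \<Rightarrow> complex) \<Rightarrow> nat \<Rightarrow> complex" where
  "taylor_coeff f n \<equiv> (deriv ^^ n) f 0 / fact n"

definition falling :: "nat \<Rightarrow> nat \<Rightarrow> complex" where
  "falling n j = fact j * of_nat (n choose j)"

lemma falling_eq_0: "n < j \<Longrightarrow> falling n j = 0"
  by (simp add: falling_def)

lemma falling_self: "falling n n = fact n"
  by (simp add: falling_def)

lemma falling_eq_prod: "falling n j = (\<Prod>i<j. of_nat n - of_nat i)"
  by (simp add: falling_def binomial_gbinomial gbinomial_prod_rev atLeast0LessThan)

text \<open>
  The Taylor series of $\phi^{(j)}$ has the coefficients $(n+j)!\,c_{n+j}/n! = (n+j)_j\,c_{n+j}$.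
  Multiplication by $x^j$ shifts the index back, and the terms with $n < j$ that the shift
  leaves out are zero because $(n)_j = 0$.
\<close>

lemma euler_power_series:
  assumes "f holomorphic_on UNIV"
  shows "(\<lambda>n. falling n j * taylor_coeff f n * x ^ n) sums (x ^ j * (deriv ^^ j) f x)"
proof -
  have "(deriv ^^ j) f holomorphic_on ball 0 (norm x + 1)"
    using holomorphic_higher_deriv[OF assms] by (auto intro: holomorphic_on_subset)
  then have "(\<lambda>n. (deriv ^^ n) ((deriv ^^ j) f) 0 / fact n * (x - 0) ^ n) sums (deriv ^^ j) f x"
    by (rule holomorphic_power_series) simp
  then have "(\<lambda>n. x ^ j * ((deriv ^^ (n + j)) f 0 / fact n * x ^ n)) sums (x ^ j * (deriv ^^ j) f x)"
    by (intro sums_mult) (simp add: funpow_add)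
  moreover have "x ^ j * ((deriv ^^ (n + j)) f 0 / fact n * x ^ n)
      = falling (n + j) j * taylor_coeff f (n + j) * x ^ (n + j)" for n
    by (simp add: falling_def binomial_fact power_add field_simps)
  ultimately have "(\<lambda>n. falling (n + j) j * taylor_coeff f (n + j) * x ^ (n + j))
      sums (x ^ j * (deriv ^^ j) f x)"
    by simp
  then show ?thesis
    by (subst (asm) sums_zero_iff_shift) (auto simp: falling_eq_0)
qed

lemma euler_finite_sum:
  assumes "f holomorphic_on UNIV" and "\<And>n. n > d \<Longrightarrow> taylor_coeff f n = 0"
  shows "x ^ j * (deriv ^^ j) f x = (\<Sum>n\<le>d. falling n j * taylor_coeff f n * x ^ n)"
  using assms(2)
  by (intro sums_unique2[OF euler_power_series[OF assms(1)]] sums_finite) (auto simp: not_le)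

lemma polynomial_if_taylor_coeff_eventually_0:
  assumes "f holomorphic_on UNIV" and "\<And>n. n > d \<Longrightarrow> taylor_coeff f n = 0"
  shows "\<exists>p. f = poly p"
proof
  show "f = poly (\<Sum>n\<le>d. monom (taylor_coeff f n) n)"
    using euler_finite_sum[OF assms, where j = 0]
    by (auto simp: poly_sum poly_monom falling_def)
qed

lemma taylor_coeff_poly: "taylor_coeff (poly p) n = coeff p n"
proof -
  have "(deriv ^^ n) (poly p) = poly ((pderiv ^^ n) p)"
  proof (induction n)
    case (Suc n)
    then show ?case
      by (auto intro!: DERIV_imp_deriv poly_DERIV)
  qed simp
  then show ?thesis
    by (simp add: poly_0_coeff_0 coeff_higher_pderiv flip: pochhammer_fact)
qed

text \<open>
  The polynomial $q = \sum_j b_j (n)_j$ is nonzero because at the least index $j$ with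
  $b_j \neq 0$ its value is $b_j\,j!$: the terms before $j$ have $b_i = 0$, those after it
  have $(j)_i = 0$.
\<close>

lemma falling_combination_finite_zeros:
  assumes "\<exists>j\<in>{1..m}. b j \<noteq> 0"
  shows "finite {n. (\<Sum>j = 1..m. b j * falling n j) = 0}"
proof -
  define q where "q = (\<Sum>j = 1..m. smult (b j) (\<Prod>i<j. [:- of_nat i, 1:]))"
  have q: "poly q (of_nat n) = (\<Sum>j = 1..m. b j * falling n j)" for n
    by (simp add: q_def poly_sum poly_prod falling_eq_prod)
  define j0 where "j0 = (LEAST j. j \<in> {1..m} \<and> b j \<noteq> 0)"
  have j0: "j0 \<in> {1..m}" "b j0 \<noteq> 0"
    using assms LeastI_ex[of "\<lambda>j. j \<in> {1..m} \<and> b j \<noteq> 0"] unfolding j0_def by blast+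
  have least: "b j = 0" if "j \<in> {1..m}" "j < j0" for j
    using not_less_Least[of j "\<lambda>j. j \<in> {1..m} \<and> b j \<noteq> 0"] that unfolding j0_def by blast
  have "poly q (of_nat j0) = (\<Sum>j = 1..m. if j = j0 then b j0 * fact j0 else 0)"
    unfolding q
  proof (intro sum.cong refl)
    fix j assume "j \<in> {1..m}"
    then show "b j * falling j0 j = (if j = j0 then b j0 * fact j0 else 0)"
      using least[of j] by (cases j j0 rule: linorder_cases) (auto simp: falling_eq_0 falling_self)
  qed
  also have "\<dots> \<noteq> 0"
    using j0 by simp
  finally have "q \<noteq> 0" by auto
  then have "finite {z. poly q z = 0}"
    by (rule poly_roots_finite)
  then have "finite (of_nat -` {z. poly q z = 0} :: nat set)"
    by (rule finite_vimageI) (simp add: inj_on_def)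
  then show ?thesis
    by (simp add: q vimage_def)
qed

lemma polynomial_if_euler_relation:
  assumes \<phi>: "\<phi> holomorphic_on UNIV"
    and rel: "\<And>x. (\<Sum>j = 1..m. b j * (x ^ j * (deriv ^^ j) \<phi> x)) = 0"
    and nz: "\<exists>j\<in>{1..m}. b j \<noteq> 0"
  shows "\<exists>p. \<phi> = poly p"
proof -
  define q where "q n = (\<Sum>j = 1..m. b j * falling n j)" for n
  have ser: "(\<lambda>n. q n * taylor_coeff \<phi> n * (x - 0) ^ n) sums 0" for x
  proof -
    have "(\<lambda>n. \<Sum>j = 1..m. b j * (falling n j * taylor_coeff \<phi> n * x ^ n))
        sums (\<Sum>j = 1..m. b j * (x ^ j * (deriv ^^ j) \<phi> x))"
      by (intro sums_sum sums_mult euler_power_series[OF \<phi>])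
    moreover have "(\<Sum>j = 1..m. b j * (falling n j * taylor_coeff \<phi> n * x ^ n))
        = q n * taylor_coeff \<phi> n * (x - 0) ^ n" for n
      by (simp only: q_def sum_distrib_right mult.assoc diff_zero)
    ultimately show ?thesis
      using rel by simp
  qed
  have coeff: "q n * taylor_coeff \<phi> n = 0" if "n > 0" for n
  proof (rule ccontr)
    assume nz: "q n * taylor_coeff \<phi> n \<noteq> 0"
    \<comment> \<open>A series with a nonzero coefficient in positive degree and value $0$ at $0$ has no other
      zero near $0$, but this one vanishes everywhere.\<close>
    show False
    proof (rule powser_0_nonzero[where r = 1 and \<xi> = 0 and f = "\<lambda>_. 0" and m = n
          and a = "\<lambda>n. q n * taylor_coeff \<phi> n"])
      show "(\<lambda>n. q n * taylor_coeff \<phi> n * (x - 0) ^ n) sums 0" for x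
        by (rule ser)
      fix s :: real
      assume s: "s > 0" "\<And>z :: complex. z \<in> cball 0 s - {0} \<Longrightarrow> (0 :: complex) \<noteq> 0"
      have "complex_of_real s \<in> cball 0 s - {0}"
        using s(1) by simp
      from s(2)[OF this] show False by simp
    qed (use nz \<open>n > 0\<close> in simp_all)
  qed
  obtain d where d: "\<And>n. q n = 0 \<Longrightarrow> n \<le> d"
    using falling_combination_finite_zeros[OF nz] unfolding q_def finite_nat_set_iff_bounded_le
    by blast
  show ?thesis
  proof (rule polynomial_if_taylor_coeff_eventually_0[OF \<phi>])
    fix n assume "n > d"
    then show "taylor_coeff \<phi> n = 0"
      using coeff[of n] d[of n] by auto
  qed
qed


section \<open>Multiplication operators\<close>

abbreviation power_op :: "nat \<Rightarrow> 'n::finite diffop" where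
  "power_op n \<equiv> fun_op (\<lambda>x. x ^ n)"

abbreviation euler_op :: "(complex \<Rightarrow> complex) \<Rightarrow> nat \<Rightarrow> 'n::finite diffop" where
  "euler_op \<phi> j \<equiv> fun_op (\<lambda>x. x ^ j * (deriv ^^ j) \<phi> x)"

lemma fun_op_zero: "fun_op (\<lambda>x. 0) = 0"
  by (auto simp: fun_op_def dterm_def fun_eq_iff)

lemma fun_op_eq_0_iff: "(fun_op f :: 'n::finite diffop) = 0 \<longleftrightarrow> f = (\<lambda>x. 0)"
proof
  assume "(fun_op f :: 'n diffop) = 0"
  then have "(fun_op f :: 'n diffop) 0 x $ r $ r = 0" for x r
    by simp
  then show "f = (\<lambda>x. 0)"
    by (simp add: fun_op_def dterm_def mat_def fun_eq_iff)
qed (simp add: fun_op_zero)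

lemma fun_op_scale: "fun_op (\<lambda>x. k * f x) = op_scale k (fun_op f)"
  by (auto simp: fun_op_def dterm_def fun_eq_iff vec_eq_iff op_scale_def mat_mult_component)
    (auto simp: mat_def)

lemma fun_op_add: "fun_op (\<lambda>x. f x + h x) = fun_op f + fun_op h"
  by (auto simp: fun_op_def dterm_def fun_eq_iff vec_eq_iff) (auto simp: mat_def)

lemma fun_op_sum:
  "fun_op (\<lambda>x. \<Sum>i\<in>I. b i * f i x) = (\<Sum>i\<in>I. op_scale (b i) (fun_op (f i)))"
  by (induction I rule: infinite_finite_induct) (simp_all add: fun_op_zero fun_op_add fun_op_scale)

lemma subspace_range_fun_op: "diffop.subspace (range fun_op)"
  by (rule diffop.subspaceI) (auto simp flip: fun_op_zero fun_op_add fun_op_scale)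

lemma independent_power_ops:
  assumes "finite S"
  shows "inj_on (power_op :: nat \<Rightarrow> 'n::finite diffop) S"
    and "diffop.independent ((power_op :: nat \<Rightarrow> 'n diffop) ` S)"
proof -
  have rel: "\<forall>i\<in>S. b i = 0"
    if "(\<Sum>n\<in>S. op_scale (b n) (power_op n :: 'n diffop)) = 0" for b
  proof
    fix i assume "i \<in> S"
    from that have "(\<lambda>x. \<Sum>n\<in>S. b n * x ^ n) = (\<lambda>x. 0)"
      unfolding fun_op_sum[symmetric] fun_op_eq_0_iff .
    then have "poly (\<Sum>n\<in>S. monom (b n) n) x = 0" for x
      by (simp add: poly_sum poly_monom fun_eq_iff)
    then have "(\<Sum>n\<in>S. monom (b n) n) = 0"
      using poly_all_0_iff_0 by blast
    then have "coeff (\<Sum>n\<in>S. monom (b n) n) i = 0"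
      by simp
    then show "b i = 0"
      using \<open>i \<in> S\<close> assms by (simp add: coeff_sum)
  qed
  show "inj_on (power_op :: nat \<Rightarrow> 'n diffop) S"
    and "diffop.independent ((power_op :: nat \<Rightarrow> 'n diffop) ` S)"
    by (rule diffop.independent_family[OF assms rel], assumption)+
qed

text \<open>
  Back substitution in the triangular system $f_n = \sum_{m \ge n} (m)_n c_m x^m$: the term of
  $x^n$ is $n!\,c_nx^n$, and the terms above it are dealt with before, so the
  induction descends from the degree bound.
\<close>

lemma taylor_term_in_span:
  assumes \<phi>: "\<phi> holomorphic_on UNIV" and d: "\<And>n. n > d \<Longrightarrow> taylor_coeff \<phi> n = 0"
    and "n \<ge> 1"
  shows "(fun_op (\<lambda>x. taylor_coeff \<phi> n * x ^ n) :: 'n::finite diffop)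
    \<in> diffop.span {euler_op \<phi> j | j. j \<ge> 1}"
  using \<open>n \<ge> 1\<close>
proof (induction "d - n" arbitrary: n rule: less_induct)
  case less
  let ?V = "diffop.span {euler_op \<phi> j | j. j \<ge> 1} :: 'n diffop set"
  let ?t = "\<lambda>n x. taylor_coeff \<phi> n * x ^ n"
  show ?case
  proof (cases "n \<le> d")
    case False
    with d[of n] have "(\<lambda>x. ?t n x) = (\<lambda>x. 0)"
      by (simp add: fun_eq_iff)
    then show ?thesis
      by (simp only: fun_op_zero diffop.span_zero)
  next
    case True
    have "?t n x = (1 / fact n) * (x ^ n * (deriv ^^ n) \<phi> x
        + (\<Sum>m\<in>{n<..d}. - falling m n * ?t m x))" for x
    proof -
      have "x ^ n * (deriv ^^ n) \<phi> x = (\<Sum>m\<le>d. falling m n * ?t m x)"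
        by (simp add: euler_finite_sum[OF \<phi> d] mult.assoc)
      also have "\<dots> = (\<Sum>m\<in>insert n {n<..d}. falling m n * ?t m x)"
        using True by (intro sum.mono_neutral_right) (auto simp: falling_eq_0)
      finally show ?thesis
        by (simp add: falling_self sum_negf)
    qed
    then have "fun_op (?t n) = op_scale (1 / fact n) (euler_op \<phi> n
        + (\<Sum>m\<in>{n<..d}. op_scale (- falling m n) (fun_op (?t m))))"
      by (simp only: fun_op_sum fun_op_add fun_op_scale)
    also have "\<dots> \<in> ?V"
    proof (intro diffop.span_scale diffop.span_add diffop.span_sum)
      show "euler_op \<phi> n \<in> ?V"
        using less.prems by (intro diffop.span_base) blast
      show "fun_op (?t m) \<in> ?V" if "m \<in> {n<..d}" for m
        using that less.prems by (intro less.hyps) auto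
    qed
    finally show ?thesis .
  qed
qed


section \<open>A basis of the Lie algebra of a polynomial\<close>

text \<open>The support of \<open>p\<close>, enlarged by the exponents of the generators $1$ and $x$.\<close>

definition exponents :: "complex poly \<Rightarrow> nat set" where
  "exponents p = insert 0 (insert 1 {n. coeff p n \<noteq> 0})"

lemma finite_coeff_support: "finite {n. coeff p n \<noteq> 0}"
  by (rule finite_subset[of _ "{..degree p}"]) (auto simp: le_degree)

lemma finite_exponents: "finite (exponents p)"
  by (simp add: exponents_def finite_coeff_support)

definition g_phi_basis ::
  "real \<Rightarrow> (nat \<Rightarrow> real) \<Rightarrow> complex poly \<Rightarrow> 'n::{finite,linorder} diffop set" where
  "g_phi_basis \<nu> a p = insert (D_op a) (insert (D_dagger \<nu> (poly p)) (power_op ` exponents p))"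

lemma span_g_phi_basis:
  "diffop.span (g_phi_basis \<nu> a p :: 'n::{finite,linorder} diffop set) = g_phi \<nu> a (poly p)"
proof
  have \<phi>: "poly p holomorphic_on UNIV"
    by (intro holomorphic_intros)
  have d: "taylor_coeff (poly p) n = 0" if "n > degree p" for n
    using that by (simp add: taylor_coeff_poly coeff_eq_0)
  let ?X = "{fun_op (\<lambda>x. 1), D_op a, D_dagger \<nu> (poly p), fun_op (\<lambda>x. x)}
      \<union> {euler_op (poly p) j | j. j \<ge> 1} :: 'n diffop set"
  have g: "g_phi \<nu> a (poly p) = diffop.span ?X"
    by (simp only: g_phi_def)
  have "power_op n \<in> diffop.span ?X" if n: "n \<in> exponents p" for n
  proof -
    consider "n = 0" | "n = 1" | "n \<ge> 1" "coeff p n \<noteq> 0"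
      using n unfolding exponents_def by (cases "n = 0") auto
    then show ?thesis
    proof cases
      case 3
      have "fun_op (\<lambda>x. taylor_coeff (poly p) n * x ^ n) \<in> diffop.span ?X"
        using taylor_term_in_span[OF \<phi> d \<open>n \<ge> 1\<close>]
        by (rule diffop.span_mono[THEN subsetD, rotated]) auto
      then have "op_scale (1 / coeff p n) (op_scale (coeff p n) (power_op n)) \<in> diffop.span ?X"
        unfolding taylor_coeff_poly fun_op_scale by (rule diffop.span_scale)
      with 3 show ?thesis by simp
    qed (auto intro: diffop.span_base)
  qed
  then have "g_phi_basis \<nu> a p \<subseteq> diffop.span ?X"
    unfolding g_phi_basis_def by (auto intro: diffop.span_base)
  then show "diffop.span (g_phi_basis \<nu> a p :: 'n diffop set) \<subseteq> g_phi \<nu> a (poly p)"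
    unfolding g by (intro diffop.span_minimal diffop.subspace_span)
  let ?B = "diffop.span (g_phi_basis \<nu> a p) :: 'n diffop set"
  have pow: "power_op n \<in> ?B" if "n \<in> exponents p" for n
    using that unfolding g_phi_basis_def by (intro diffop.span_base) blast
  have "euler_op (poly p) j \<in> ?B" for j
  proof -
    have "x ^ j * (deriv ^^ j) (poly p) x
        = (\<Sum>n\<le>degree p. (falling n j * coeff p n) * x ^ n)" for x
      using euler_finite_sum[OF \<phi> d] by (simp only: taylor_coeff_poly)
    then have "euler_op (poly p) j
        = (\<Sum>n\<le>degree p. op_scale (falling n j * coeff p n) (power_op n))"
      by (simp only: fun_op_sum)
    also have "\<dots> \<in> ?B"
    proof (rule diffop.span_sum)
      fix n
      show "op_scale (falling n j * coeff p n) (power_op n) \<in> ?B"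
      proof (cases "coeff p n = 0")
        case False
        then show ?thesis
          by (intro diffop.span_scale pow) (simp add: exponents_def)
      qed (simp add: diffop.span_zero)
    qed
    finally show ?thesis .
  qed
  moreover have "D_op a \<in> ?B" "D_dagger \<nu> (poly p) \<in> ?B"
    unfolding g_phi_basis_def by (auto intro: diffop.span_base)
  moreover have "fun_op (\<lambda>x. 1) \<in> ?B" "fun_op (\<lambda>x. x) \<in> ?B"
    using pow[of 0] pow[of 1] by (simp_all add: exponents_def)
  ultimately have "?X \<subseteq> ?B"
    by blast
  then show "g_phi \<nu> a (poly p) \<subseteq> ?B"
    unfolding g by (intro diffop.span_minimal diffop.subspace_span)
qed

lemma D_dagger_not_fun_op: "D_dagger \<nu> \<phi> \<noteq> (fun_op f :: 'n::{finite,linorder} diffop)"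
proof
  assume "D_dagger \<nu> \<phi> = (fun_op f :: 'n diffop)"
  then have "(D_dagger \<nu> \<phi> :: 'n diffop) 1 1 $ r $ r = (fun_op f :: 'n diffop) 1 1 $ r $ r" for r
    by simp
  then show False
    by (simp add: D_dagger_def fun_op_def dterm_def mat_def)
qed

text \<open>
  The coefficient of $\partial_x$ forces $k = -1$. At $x = 0$ the zeroth order coefficients then
  say that $1 + \nu + J$ is a multiple of the identity, but the diagonal entries of $J$ differ.
\<close>

lemma D_op_not_D_dagger_plus_fun_op:
  assumes "CARD('n::{finite,linorder}) \<ge> 2"
  shows "D_op a \<noteq> op_scale k (D_dagger \<nu> \<phi>) + (fun_op f :: 'n diffop)"
proof
  assume "D_op a = op_scale k (D_dagger \<nu> \<phi>) + (fun_op f :: 'n diffop)"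
  then have eq: "(D_op a :: 'n diffop) j x $ r $ r
      = k * (D_dagger \<nu> \<phi> :: 'n diffop) j x $ r $ r + (fun_op f :: 'n diffop) j x $ r $ r" for j x r
    by (simp add: op_scale_def mat_mult_component)
  from eq[of 1 1 undefined] have k: "k = - 1"
    by (simp add: D_op_def D_dagger_def fun_op_def dterm_def mat_def) (simp add: minus_equation_iff)
  have *: "1 + of_real \<nu> + of_nat (pos r) + f 0 = 0" for r :: 'n
    using eq[of 0 0 r] unfolding k
    by (simp add: D_op_def D_dagger_def fun_op_def dterm_def mat_mult_component J_mat_component)
      (simp add: mat_def algebra_simps)
  have "\<not> CARD('n) \<le> Suc 0"
    using assms by simp
  then obtain r s :: 'n where "r \<noteq> s"
    by (subst (asm) card_le_Suc0_iff_eq) auto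
  moreover have "1 + of_real \<nu> + of_nat (pos r) + f 0 = 1 + of_real \<nu> + of_nat (pos s) + f 0"
    by (simp only: *)
  ultimately show False
    by simp
qed

lemma independent_g_phi_basis:
  assumes "CARD('n::{finite,linorder}) \<ge> 2"
  shows "diffop.independent (g_phi_basis \<nu> a p :: 'n diffop set)"
    and "card (g_phi_basis \<nu> a p :: 'n diffop set) = card (exponents p) + 2"
proof -
  let ?F = "power_op ` exponents p :: 'n diffop set"
  have F: "\<exists>f. E = fun_op f" if "E \<in> diffop.span ?F" for E
    using diffop.span_minimal[OF _ subspace_range_fun_op, of ?F] that by blast
  have 1: "D_dagger \<nu> (poly p) \<notin> diffop.span ?F"
    using F D_dagger_not_fun_op by blast
  have 2: "D_op a \<notin> diffop.span (insert (D_dagger \<nu> (poly p)) ?F)"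
  proof
    assume "D_op a \<in> diffop.span (insert (D_dagger \<nu> (poly p)) ?F)"
    then obtain k where "D_op a - op_scale k (D_dagger \<nu> (poly p)) \<in> diffop.span ?F"
      unfolding diffop.span_insert by blast
    then obtain f where "D_op a - op_scale k (D_dagger \<nu> (poly p)) = (fun_op f :: 'n diffop)"
      using F by blast
    then have "D_op a = op_scale k (D_dagger \<nu> (poly p)) + (fun_op f :: 'n diffop)"
      by (simp add: algebra_simps)
    with D_op_not_D_dagger_plus_fun_op[OF assms] show False
      by blast
  qed
  show "diffop.independent (g_phi_basis \<nu> a p :: 'n diffop set)"
    unfolding g_phi_basis_def
    by (intro diffop.independent_insertI 1 2 independent_power_ops finite_exponents)
  have "D_dagger \<nu> (poly p) \<notin> ?F" "D_op a \<notin> insert (D_dagger \<nu> (poly p)) ?F"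
    using 1 2 diffop.span_superset by (meson subsetD)+
  moreover have "card ?F = card (exponents p)"
    by (intro card_image independent_power_ops finite_exponents)
  ultimately show "card (g_phi_basis \<nu> a p :: 'n diffop set) = card (exponents p) + 2"
    unfolding g_phi_basis_def by (simp add: finite_exponents)
qed

lemma card_exponents:
  "card (exponents p) =
     (let l = card {i. coeff p i \<noteq> 0}
      in if poly p 0 = 0 \<and> deriv (poly p) 0 = 0 then l + 2
         else if poly p 0 = 0 \<or> deriv (poly p) 0 = 0 then l + 1
         else l)"
proof -
  have "deriv (poly p) 0 = coeff p 1"
    using taylor_coeff_poly[where p = p and n = 1] by simp
  then show ?thesis
    by (simp add: exponents_def finite_coeff_support card_insert_if poly_0_coeff_0 Let_def)
qed


section \<open>The dimension of the Lie algebra\<close>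

lemma polynomial_if_op_finite_dim:
  fixes \<phi> :: "complex \<Rightarrow> complex"
  assumes \<phi>: "\<phi> holomorphic_on UNIV"
    and "op_finite_dim (g_phi \<nu> a \<phi> :: 'n::{finite,linorder} diffop set)"
  shows "\<exists>p. \<phi> = poly p"
proof -
  obtain B :: "'n diffop set" where B: "finite B" "diffop.span B = g_phi \<nu> a \<phi>"
    using assms(2) unfolding op_finite_dim_def by blast
  have "euler_op \<phi> j \<in> diffop.span B" if "j \<ge> 1" for j
    unfolding B(2) g_phi_def using that by (intro diffop.span_base) blast
  then obtain b m where
    rel: "(\<Sum>j = 1..m. op_scale (b j) (euler_op \<phi> j :: 'n diffop)) = 0"
    and nz: "\<exists>j\<in>{1..m}. b j \<noteq> 0"
    by (rule diffop.dependent_sequence[OF B(1)])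
  from rel have "(\<lambda>x. \<Sum>j = 1..m. b j * (x ^ j * (deriv ^^ j) \<phi> x)) = (\<lambda>x. 0)"
    unfolding fun_op_sum[symmetric] fun_op_eq_0_iff .
  then show ?thesis
    using polynomial_if_euler_relation[OF \<phi> _ nz] by (simp add: fun_eq_iff)
qed

lemma op_finite_dim_poly:
  "op_finite_dim (g_phi \<nu> a (poly p) :: 'n::{finite,linorder} diffop set)"
proof -
  have "finite (g_phi_basis \<nu> a p :: 'n diffop set)"
    by (simp add: g_phi_basis_def finite_exponents)
  then show ?thesis
    unfolding op_finite_dim_def using span_g_phi_basis by blast
qed


theorem proposition4p2:
  fixes \<phi> :: "complex \<Rightarrow> complex" and \<nu> :: real and a :: "nat \<Rightarrow> real"
    and g :: "'n::{finite,linorder} diffop set"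
  assumes "\<nu> > 0"
    and "\<phi> holomorphic_on UNIV"
    and "g = g_phi \<nu> a \<phi>"
  shows "(op_finite_dim g \<longleftrightarrow> (\<exists>p. \<phi> = poly p)) \<and>
    (CARD('n) \<ge> 2 \<longrightarrow> (\<forall>p. \<phi> = poly p \<longrightarrow>
      (let l = card {i. coeff p i \<noteq> 0};
           k = (if \<phi> 0 = 0 \<and> deriv \<phi> 0 = 0 then l + 2
                else if \<phi> 0 = 0 \<or> deriv \<phi> 0 = 0 then l + 1
                else l)
       in diffop.dim g = k + 2)))"
proof (intro conjI impI allI)
  show "op_finite_dim g \<longleftrightarrow> (\<exists>p. \<phi> = poly p)"
    using polynomial_if_op_finite_dim[OF assms(2)] op_finite_dim_poly assms(3) by blast
next
  fix p assume N: "CARD('n) \<ge> 2" and p: "\<phi> = poly p"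
  have "diffop.dim g = card (exponents p) + 2"
    unfolding assms(3) p
    unfolding span_g_phi_basis[symmetric]
    by (subst diffop.dim_span_eq_card_independent) (rule independent_g_phi_basis[OF N])+
  then show "let l = card {i. coeff p i \<noteq> 0};
           k = (if \<phi> 0 = 0 \<and> deriv \<phi> 0 = 0 then l + 2
                else if \<phi> 0 = 0 \<or> deriv \<phi> 0 = 0 then l + 1
                else l)
       in diffop.dim g = k + 2"
    by (simp add: p card_exponents Let_def)
qed

end
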